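(* Let $n\ge 1$. A real positive definite matrix $S$ of order $2n$ belongs to $K_n$ if and only if there exist symplectic matrices $L,M\in Sp(2n,\mathbb{R})$ such that $$S=\tfrac14\left(L^TL+M^TM\right).$$ Furthermore, $S$ is an extreme point of the convex set $K_n$ if and only if $S=\tfrac12 L^TL$ for some symplectic matrix $L\in Sp(2n,\mathbb{R})$.
   Context: "Real positive definite" means real symmetric with $x^TSx\ge 0$ for all real vectors $x$ (strict positivity is called "strictly positive definite"). Put $J=\begin{bmatrix}0&-I\\ I&0\end{bmatrix}$ in $n\times n$ blocks. $Sp(2n,\mathbb{R})$ is the group of real $2n\times 2n$ matrices $L$ with $L^TJL=J$; its elements are called symplectic. $K_n$ is the closed convex set of all real symmetric matrices $S$ of order $2n$ such that the complex Hermitian matrix $2S-iJ$ satisfies $2S-iJ\ge 0$ (positive semidefinite). *)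

theory Defs
  imports "HOL-Analysis.Analysis"
begin

text \<open>
  Matrices of order \<open>2n\<close> are indexed by the sum type \<open>'n + 'n\<close>, where \<open>n = CARD('n)\<close>:
  \<open>Inl\<close> and \<open>Inr\<close> select the first and second half of the rows (or columns), so that
  the decomposition into \<open>n \<times> n\<close> blocks is part of the type.
\<close>

type_synonym 'n rmat2 = "real ^ ('n + 'n) ^ ('n + 'n)"

definition real_pos_def :: "real ^ 'm ^ 'm \<Rightarrow> bool" where
  "real_pos_def S \<longleftrightarrow> transpose S = S \<and> (\<forall>x. 0 \<le> x \<bullet> (S *v x))"

definition complex_psd :: "complex ^ 'm ^ 'm \<Rightarrow> bool" where
  "complex_psd H \<longleftrightarrow>
     (\<forall>i j. H $ i $ j = cnj (H $ j $ i)) \<and>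
     (\<forall>z. 0 \<le> Re (\<Sum>i\<in>UNIV. cnj (z $ i) * (H *v z) $ i))"
  \<comment> \<open>The quadratic form of a Hermitian matrix is real-valued, so \<open>Re\<close> loses nothing.\<close>

definition symp_J :: "'n::finite rmat2" where
  "symp_J = (\<chi> i j. case (i, j) of
       (Inl a, Inr b) \<Rightarrow> if a = b then - 1 else 0
     | (Inr a, Inl b) \<Rightarrow> if a = b then 1 else 0
     | _ \<Rightarrow> 0)"

definition Sp :: "'n::finite rmat2 set" where
  "Sp = {L. transpose L ** symp_J ** L = symp_J}"

definition K :: "'n::finite rmat2 set" where
  "K = {S. transpose S = S \<and>
          complex_psd (\<chi> i j. 2 * complex_of_real (S $ i $ j)
                              - \<i> * complex_of_real (symp_J $ i $ j))}"

end

theory Submission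
  imports Defs
begin

text \<open>
  For \<open>S\<close> in \<open>K\<close>, Williamson's normal form \<open>S = L\<^sup>T diag(d, d) L\<close> with \<open>L\<close> symplectic and
  all \<open>d\<^sub>i \<ge> 1/2\<close> is built one symplectic pair at a time: a pair maximising
  \<open>x\<^sup>T J y / (x\<^sup>T S x + y\<^sup>T S y)\<close> on the \<open>J\<close>-complement of the previous ones satisfies
  \<open>S e = d J f\<close> and \<open>S f = - d J e\<close>. Writing \<open>4 d = a\<^sup>2 + a\<^sup>-\<^sup>2\<close> splits \<open>diag(d, d)\<close> into
  the squares of the symplectic matrices \<open>diag(a, 1/a)\<close> and \<open>diag(1/a, a)\<close>. So an extreme
  point, being a midpoint of two matrices \<open>L\<^sup>T L / 2\<close> in \<open>K\<close>, equals both of them. Conversely the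
  form \<open>x\<^sup>T S x + y\<^sup>T S y + x\<^sup>T J y\<close> of \<open>S = L\<^sup>T L / 2\<close> has so many zeros that
  any member of \<open>K\<close> whose form vanishes there must be \<open>S\<close>.
\<close>

section \<open>Bilinear forms of real matrices, the matrix \<open>symp_J\<close>, and the real
  description of \<open>K\<close>\<close>

lemma dot_matrix_vector:
  "(x::real^'m) \<bullet> (A *v y) = (\<Sum>i\<in>UNIV. \<Sum>j\<in>UNIV. x $ i * A $ i $ j * y $ j)"
  by (simp add: inner_vec_def matrix_vector_mult_def sum_distrib_left mult.assoc)

lemma dot_matrix_transpose: "(x::real^'m) \<bullet> (A *v y) = (transpose A *v x) \<bullet> y"
  by (simp add: dot_lmul_matrix)

lemma symp_J_nth:
  "symp_J $ Inl a $ Inl b = 0" "symp_J $ Inr a $ Inr b = 0"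
  "symp_J $ Inl a $ Inr b = (if a = b then - 1 else 0)"
  "symp_J $ Inr a $ Inl b = (if a = b then 1 else 0)"
  by (simp_all add: symp_J_def)

lemma sum_UNIV_Plus:
  "(\<Sum>k\<in>(UNIV::('a::finite + 'b::finite) set). g k) = (\<Sum>a\<in>UNIV. g (Inl a)) + (\<Sum>b\<in>UNIV. g (Inr b))"
  using sum.Plus[of UNIV UNIV g] by simp

lemma transpose_uminus: "transpose (- A) = - transpose (A :: real^'m^'m)"
  by (simp add: transpose_def vec_eq_iff)

lemma transpose_symp_J: "transpose symp_J = - (symp_J :: 'n::finite rmat2)"
proof -
  have "transpose symp_J $ i $ j = - (symp_J :: 'n rmat2) $ i $ j" for i j
    by (cases i; cases j) (auto simp: symp_J_nth transpose_def)
  then show ?thesis by (simp add: vec_eq_iff)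
qed

lemma symp_J_squared: "symp_J ** symp_J = - (mat 1 :: 'n::finite rmat2)"
proof -
  have "(symp_J ** symp_J) $ i $ j = - (mat 1 :: 'n rmat2) $ i $ j" for i j
    by (cases i; cases j)
      (auto simp: symp_J_nth matrix_matrix_mult_def sum_UNIV_Plus mat_def if_distrib if_distribR
        sum.delta' cong: if_cong)
  then show ?thesis by (simp add: vec_eq_iff)
qed

lemma uminus_matrix_vector_mult: "(- A) *v (x::real^'m) = - (A *v x)"
  by (simp add: matrix_vector_mult_def vec_eq_iff sum_negf)

lemma symp_J_symp_J_vector: "symp_J *v (symp_J *v x) = - (x :: real^('n::finite + 'n))"
  by (simp add: matrix_vector_mul_assoc symp_J_squared uminus_matrix_vector_mult)

lemma dot_skew:
  assumes "transpose B = - B"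
  shows "(x::real^'m) \<bullet> (B *v y) = - (y \<bullet> (B *v x))"
  using dot_matrix_transpose[of x B y, unfolded assms uminus_matrix_vector_mult]
  by (simp add: inner_commute)

lemma dot_symmetric:
  assumes "transpose A = A"
  shows "(x::real^'m) \<bullet> (A *v y) = y \<bullet> (A *v x)"
  using dot_matrix_transpose[of x A y, unfolded assms] by (simp only: inner_commute)

lemma dot_symp_J: "(x :: real^('n::finite + 'n)) \<bullet> (symp_J *v y) = - (y \<bullet> (symp_J *v x))"
  by (rule dot_skew[OF transpose_symp_J])

lemma dot_symp_J_self: "(x :: real^('n::finite + 'n)) \<bullet> (symp_J *v x) = 0"
  using dot_symp_J[of x x] by simp

lemma norm_symp_J: "(symp_J *v x) \<bullet> (symp_J *v x) = (x :: real^('n::finite + 'n)) \<bullet> x"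
  using dot_symp_J[of "symp_J *v x" x] by (simp add: symp_J_symp_J_vector)

text \<open>The complex condition on \<open>z = x + \<i> y\<close>, written out for the real vectors \<open>x\<close> and \<open>y\<close>.\<close>

lemma K_iff:
  fixes S :: "'n::finite rmat2"
  shows "S \<in> K \<longleftrightarrow> transpose S = S \<and>
    (\<forall>x y. 0 \<le> x \<bullet> (S *v x) + y \<bullet> (S *v y) + x \<bullet> (symp_J *v y))"
proof (cases "transpose S = S")
  case True
  define H where "H = (\<chi> i j. 2 * complex_of_real (S $ i $ j) - \<i> * complex_of_real (symp_J $ i $ j))"
  have S: "S $ j $ i = S $ i $ j" for i j
    using arg_cong[OF True, of "\<lambda>A. A $ i $ j"] by (simp add: transpose_def)
  have J: "(symp_J :: 'n rmat2) $ j $ i = - symp_J $ i $ j" for i j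
    using arg_cong[OF transpose_symp_J, of "\<lambda>A. A $ i $ j"] by (simp add: transpose_def)
  have herm: "H $ i $ j = cnj (H $ j $ i)" for i j
    unfolding H_def using S[of i j] J[of i j] by simp
  \<comment> \<open>The factor 2 is common to all three terms: the part \<open>- \<i> J\<close>
    contributes \<open>x\<^sup>T J y - y\<^sup>T J x\<close>, which is
    \<open>2 x\<^sup>T J y\<close> because \<open>J\<close> is skew.\<close>
  have form: "Re (\<Sum>i\<in>UNIV. cnj (z $ i) * (H *v z) $ i) =
      2 * (x \<bullet> (S *v x) + y \<bullet> (S *v y) + x \<bullet> (symp_J *v y))"
    if "x = (\<chi> i. Re (z $ i))" "y = (\<chi> i. Im (z $ i))" for z x y
  proof -
    have "Re (\<Sum>i\<in>UNIV. cnj (z $ i) * (H *v z) $ i) =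
       (\<Sum>i\<in>UNIV. \<Sum>j\<in>UNIV. Re (cnj (z $ i) * (H $ i $ j * z $ j)))"
      by (simp add: matrix_vector_mult_def sum_distrib_left Re_sum del: times_complex.sel)
    also have "\<dots> = (\<Sum>i\<in>UNIV. \<Sum>j\<in>UNIV. 2 * (x $ i * S $ i $ j * x $ j) +
        2 * (y $ i * S $ i $ j * y $ j) + x $ i * symp_J $ i $ j * y $ j - y $ i * symp_J $ i $ j * x $ j)"
      by (intro sum.cong refl) (simp add: that H_def algebra_simps)
    also have "\<dots> = 2 * (x \<bullet> (S *v x)) + 2 * (y \<bullet> (S *v y)) + x \<bullet> (symp_J *v y) - y \<bullet> (symp_J *v x)"
      by (simp add: dot_matrix_vector sum.distrib sum_subtractf sum_distrib_left)
    finally show ?thesis using dot_symp_J[of y x] by simp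
  qed
  have "complex_psd H \<longleftrightarrow> (\<forall>x y. 0 \<le> x \<bullet> (S *v x) + y \<bullet> (S *v y) + x \<bullet> (symp_J *v y))"
  proof
    assume H: "complex_psd H"
    show "\<forall>x y. 0 \<le> x \<bullet> (S *v x) + y \<bullet> (S *v y) + x \<bullet> (symp_J *v y)"
    proof (intro allI)
      fix x y :: "real^('n + 'n)"
      let ?z = "\<chi> i. Complex (x $ i) (y $ i)"
      have xy: "x = (\<chi> i. Re (?z $ i))" "y = (\<chi> i. Im (?z $ i))" by (simp_all add: vec_eq_iff)
      have "0 \<le> Re (\<Sum>i\<in>UNIV. cnj (?z $ i) * (H *v ?z) $ i)"
        using H unfolding complex_psd_def by blast
      then show "0 \<le> x \<bullet> (S *v x) + y \<bullet> (S *v y) + x \<bullet> (symp_J *v y)"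
        unfolding form[OF xy] by (simp only: zero_le_mult_iff) simp
    qed
  next
    assume q: "\<forall>x y. 0 \<le> x \<bullet> (S *v x) + y \<bullet> (S *v y) + x \<bullet> (symp_J *v y)"
    have "0 \<le> Re (\<Sum>i\<in>UNIV. cnj (z $ i) * (H *v z) $ i)" for z
      unfolding form[OF refl refl] by (rule mult_nonneg_nonneg[OF zero_le_numeral q[rule_format]])
    then show "complex_psd H"
      unfolding complex_psd_def using herm by blast
  qed
  then show ?thesis using True by (simp add: K_def H_def)
qed (simp add: K_def)

section \<open>Zeros of nonnegative forms and the extremal pair\<close>

lemma linear_coefficient_eq_0:
  fixes a b :: real
  assumes "\<And>t. 0 \<le> a * t\<^sup>2 + b * t"
  shows "b = 0"
proof (rule ccontr)
  assume "b \<noteq> 0"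
  \<comment> \<open>Replacing \<open>a\<close> by a positive upper bound avoids cases on its sign;
    \<open>- b / (2 * c)\<close> is the minimiser of \<open>c t\<^sup>2 + b t\<close>, where the
    value is negative.\<close>
  define c where "c = \<bar>a\<bar> + 1"
  have "c > 0" by (simp add: c_def)
  have "0 \<le> a * (- b / (2 * c))\<^sup>2 + b * (- b / (2 * c))" by (rule assms)
  also have "\<dots> \<le> c * (- b / (2 * c))\<^sup>2 + b * (- b / (2 * c))"
    by (intro add_right_mono mult_right_mono) (auto simp: c_def)
  also have "\<dots> = - b\<^sup>2 / (4 * c)"
    using \<open>c > 0\<close> by (simp add: field_simps power2_eq_square)
  also have "\<dots> < 0" using \<open>b \<noteq> 0\<close> \<open>c > 0\<close> by simp
  finally show False by simp
qed

text \<open>A zero of a nonnegative form is a minimum on \<open>V \<times> V\<close>, so the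
  derivatives in the directions \<open>(h, 0)\<close> and \<open>(0, h)\<close> vanish. General
  \<open>A\<close>, \<open>B\<close> and \<open>V\<close> serve two uses: a member of
  \<open>K\<close> with \<open>symp_J\<close> on the whole space, and a multiple of \<open>S\<close>
  with \<open>- symp_J\<close> on a subspace.\<close>

lemma stationary_at_zero:
  fixes A B :: "real^'m^'m"
  assumes A: "transpose A = A" and B: "transpose B = - B" and V: "subspace V"
    and nonneg: "\<And>x y. x \<in> V \<Longrightarrow> y \<in> V \<Longrightarrow> 0 \<le> x \<bullet> (A *v x) + y \<bullet> (A *v y) + x \<bullet> (B *v y)"
    and "e \<in> V" "f \<in> V" "e \<bullet> (A *v e) + f \<bullet> (A *v f) + e \<bullet> (B *v f) = 0" "h \<in> V"
  shows "2 * (h \<bullet> (A *v e)) + h \<bullet> (B *v f) = 0" "2 * (h \<bullet> (A *v f)) - h \<bullet> (B *v e) = 0"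
proof -
  have "0 \<le> (h \<bullet> (A *v h)) * t\<^sup>2 + (2 * (h \<bullet> (A *v e)) + h \<bullet> (B *v f)) * t" for t
    using nonneg[of "e + t *\<^sub>R h" f] assms(5-8) dot_symmetric[OF A, of e h] V
    by (simp add: subspace_add subspace_scale matrix_vector_right_distrib matrix_vector_mult_scaleR
        inner_add power2_eq_square algebra_simps)
  then show "2 * (h \<bullet> (A *v e)) + h \<bullet> (B *v f) = 0" by (rule linear_coefficient_eq_0)
  have "0 \<le> (h \<bullet> (A *v h)) * t\<^sup>2 + (2 * (h \<bullet> (A *v f)) - h \<bullet> (B *v e)) * t" for t
    using nonneg[of e "f + t *\<^sub>R h"] assms(5-8) dot_symmetric[OF A, of f h] dot_skew[OF B, of e h] V
    by (simp add: subspace_add subspace_scale matrix_vector_right_distrib matrix_vector_mult_scaleR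
        inner_add power2_eq_square algebra_simps)
  then show "2 * (h \<bullet> (A *v f)) - h \<bullet> (B *v e) = 0" by (rule linear_coefficient_eq_0)
qed

text \<open>If \<open>x\<^sup>T S x = 0\<close>, the form vanishes at \<open>(x, 0)\<close>;
  stationarity in the second argument then makes \<open>J x\<close> orthogonal to everything, and
  \<open>J\<close> is an isometry.\<close>

lemma K_pos_def:
  assumes S: "S \<in> K" and "x \<noteq> 0"
  shows "0 < x \<bullet> (S *v x)"
proof -
  have q: "0 \<le> x \<bullet> (S *v x) + y \<bullet> (S *v y) + x \<bullet> (symp_J *v y)" and s: "transpose S = S" for x y
    using S by (auto simp: K_iff)
  have "0 \<le> x \<bullet> (S *v x)" using q[of x 0] by simp
  moreover have "x \<bullet> (S *v x) \<noteq> 0"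
  proof
    assume "x \<bullet> (S *v x) = 0"
    then have "2 * (h \<bullet> (S *v 0)) - h \<bullet> (symp_J *v x) = 0" for h
      by (intro stationary_at_zero(2)[OF s transpose_symp_J subspace_UNIV q]) auto
    from this[of "symp_J *v x"] have "x = 0" by (simp add: norm_symp_J)
    then show False using \<open>x \<noteq> 0\<close> by simp
  qed
  ultimately show ?thesis by simp
qed

text \<open>At a maximising pair the ratio has value \<open>1 / (2 d)\<close>, and membership in \<open>K\<close> bounds it by 1.\<close>

lemma williamson_pair:
  fixes S :: "'n::finite rmat2"
  assumes S: "S \<in> K" and V: "subspace V" and "x0 \<in> V" "y0 \<in> V" "x0 \<bullet> (symp_J *v y0) > 0"
  obtains e f d where "e \<in> V" "f \<in> V" "d \<ge> 1/2" "e \<bullet> (symp_J *v f) = 1"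
    "\<And>h. h \<in> V \<Longrightarrow> h \<bullet> (S *v e) = d * (h \<bullet> (symp_J *v f))"
    "\<And>h. h \<in> V \<Longrightarrow> h \<bullet> (S *v f) = - d * (h \<bullet> (symp_J *v e))"
proof -
  have sym: "transpose S = S"
    and q: "0 \<le> x \<bullet> (S *v x) + y \<bullet> (S *v y) + x \<bullet> (symp_J *v y)" for x y
    using S by (auto simp: K_iff)
  define N where "N z = fst z \<bullet> (S *v fst z) + snd z \<bullet> (S *v snd z)" for z
  define P where "P z = fst z \<bullet> ((symp_J :: 'n rmat2) *v snd z)" for z
  have N_pos: "N z > 0" if "z \<noteq> 0" for z
  proof -
    have "x \<bullet> (S *v x) \<ge> 0" for x using q[of x 0] by simp
    moreover have "fst z \<noteq> 0 \<or> snd z \<noteq> 0" using that by (auto simp: prod_eq_iff)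
    ultimately show ?thesis unfolding N_def
      using K_pos_def[OF S] by (metis add_nonneg_pos add_pos_nonneg)
  qed
  have N_scale: "N (c *\<^sub>R z) = c\<^sup>2 * N z" and P_scale: "P (c *\<^sub>R z) = c\<^sup>2 * P z" for c z
    by (simp_all add: N_def P_def matrix_vector_mult_scaleR power2_eq_square algebra_simps)
  \<comment> \<open>\<open>P\<close> and \<open>N\<close> are both homogeneous of degree 2, so the
    ratio is constant along rays and a maximum over the compact unit sphere of
    \<open>V \<times> V\<close> is a maximum over all nonzero pairs.\<close>
  define C where "C = sphere 0 1 \<inter> V \<times> V"
  have scaled: "(1 / norm z) *\<^sub>R z \<in> C" if "z \<in> V \<times> V" "z \<noteq> 0" for z
    using that V by (auto simp: C_def subspace_scale)
  have ratio: "P ((1 / norm z) *\<^sub>R z) / N ((1 / norm z) *\<^sub>R z) = P z / N z" if "z \<noteq> 0" for z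
    using that by (simp add: N_scale P_scale)
  have z0: "(x0, y0) \<in> V \<times> V" "(x0, y0) \<noteq> 0" "P (x0, y0) > 0"
    using assms(3-5) by (auto simp: P_def zero_prod_def)
  have "compact C"
    unfolding C_def using V by (intro compact_Int_closed closed_Times closed_subspace) auto
  moreover have "C \<noteq> {}" using scaled z0 by blast
  moreover have "continuous_on C (\<lambda>z. P z / N z)"
  proof -
    have cont: "continuous_on C (\<lambda>z. A *v g z)" if "continuous_on C g" for g and A :: "'n rmat2"
      using bounded_linear.continuous_on[OF _ that] matrix_vector_mul_bounded_linear by blast
    have "N z \<noteq> 0" if "z \<in> C" for z
      using N_pos[of z] that by (force simp: C_def)
    then show ?thesis unfolding N_def P_def
      by (intro continuous_intros ballI cont)
  qed
  ultimately obtain w where w: "w \<in> C" "\<And>z. z \<in> C \<Longrightarrow> P z / N z \<le> P w / N w"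
    using continuous_attains_sup[of C "\<lambda>z. P z / N z"] by blast
  define l where "l = P w / N w"
  have w0: "w \<noteq> 0" and wV: "fst w \<in> V" "snd w \<in> V" using w(1) by (auto simp: C_def)
  have le: "P z \<le> l * N z" if "z \<in> V \<times> V" for z
  proof (cases "z = 0")
    case False
    have "P z / N z \<le> l" using w(2)[OF scaled[OF that False]] ratio[OF False] by (simp add: l_def)
    then show ?thesis using N_pos[OF False] by (simp add: field_simps)
  qed (simp add: P_def N_def)
  have l: "l > 0"
    using le[OF z0(1)] z0(3) N_pos[OF z0(2)] by (smt (verit) mult_nonpos_nonneg)
  have Pw: "P w = l * N w" using N_pos[OF w0] by (simp add: l_def)
  \<comment> \<open>The sign change in the second vector turns the defining inequality of
    \<open>K\<close> into \<open>P \<le> N\<close>. The resulting \<open>l \<le> 1\<close> is what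
    makes \<open>d = 1 / (2 * l)\<close> at least 1/2.\<close>
  have "P w \<le> N w"
    using q[of "fst w" "- snd w"] by (simp add: P_def N_def vec.neg)
  then have l1: "l \<le> 1" using Pw N_pos[OF w0] by simp
  have lS: "transpose (l *\<^sub>R S) = l *\<^sub>R S" using sym by (simp add: transpose_scalar)
  have mJ: "transpose (- symp_J) = - (- symp_J :: 'n rmat2)"
    using transpose_symp_J[where 'n = 'n] by (simp add: transpose_uminus)
  have scS: "(l *\<^sub>R S) *v x = l *\<^sub>R (S *v x)" for x
    by (simp add: scaleR_matrix_vector_assoc)
  \<comment> \<open>Maximality, \<open>P \<le> l N\<close> on \<open>V \<times> V\<close> with
    equality at \<open>w\<close>, is nonnegativity of the form built from \<open>l S\<close> and
    \<open>- J\<close>, with a zero at \<open>w\<close>.\<close>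
  have pos: "0 \<le> x \<bullet> ((l *\<^sub>R S) *v x) + y \<bullet> ((l *\<^sub>R S) *v y) + x \<bullet> ((- symp_J) *v y)"
    if "x \<in> V" "y \<in> V" for x y
    using le[of "(x, y)"] that
    by (simp add: scS uminus_matrix_vector_mult N_def P_def algebra_simps)
  have zero: "fst w \<bullet> ((l *\<^sub>R S) *v fst w) + snd w \<bullet> ((l *\<^sub>R S) *v snd w) + fst w \<bullet> ((- symp_J) *v snd w) = 0"
    using Pw by (simp add: scS uminus_matrix_vector_mult N_def P_def algebra_simps)
  have st: "2 * l * (h \<bullet> (S *v fst w)) = h \<bullet> (symp_J *v snd w)"
    "2 * l * (h \<bullet> (S *v snd w)) = - (h \<bullet> (symp_J *v fst w))" if "h \<in> V" for h
    using stationary_at_zero[OF lS mJ V pos wV zero that]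
    by (simp_all add: scS uminus_matrix_vector_mult algebra_simps)
  \<comment> \<open>Scaling both vectors by \<open>c\<close> normalises the pairing to 1 and leaves
    the stationarity equations intact, since these are linear in \<open>w\<close>.\<close>
  define c where "c = 1 / sqrt (P w)"
  have Pw0: "P w > 0" using Pw l N_pos[OF w0] by simp
  have c: "c * c * P w = 1" using Pw0 by (simp add: c_def)
  show ?thesis
  proof (rule that[of "c *\<^sub>R fst w" "c *\<^sub>R snd w" "1 / (2 * l)"])
    show "c *\<^sub>R fst w \<in> V" "c *\<^sub>R snd w \<in> V" using wV V by (simp_all add: subspace_scale)
    show "1 / 2 \<le> 1 / (2 * l)" using l l1 by (simp add: field_simps)
    show "c *\<^sub>R fst w \<bullet> (symp_J *v (c *\<^sub>R snd w)) = 1"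
      using c by (simp add: P_def matrix_vector_mult_scaleR mult.assoc)
    fix h assume "h \<in> V"
    from st[OF this] show "h \<bullet> (S *v (c *\<^sub>R fst w)) = 1 / (2 * l) * (h \<bullet> (symp_J *v (c *\<^sub>R snd w)))"
      "h \<bullet> (S *v (c *\<^sub>R snd w)) = - (1 / (2 * l)) * (h \<bullet> (symp_J *v (c *\<^sub>R fst w)))"
      using l by (simp_all add: matrix_vector_mult_scaleR field_simps)
  qed
qed

section \<open>Partial Darboux bases and their symplectic complements\<close>

definition symplectic_family :: "'i set \<Rightarrow> ('i \<Rightarrow> real^('n::finite + 'n)) \<Rightarrow> ('i \<Rightarrow> real^('n + 'n)) \<Rightarrow> bool" where
  "symplectic_family I e f \<longleftrightarrow> (\<forall>i\<in>I. \<forall>j\<in>I. e i \<bullet> (symp_J *v f j) = (if i = j then 1 else 0) \<and>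
     e i \<bullet> (symp_J *v e j) = 0 \<and> f i \<bullet> (symp_J *v f j) = 0)"

definition symp_complement :: "'i set \<Rightarrow> ('i \<Rightarrow> real^('n::finite + 'n)) \<Rightarrow> ('i \<Rightarrow> real^('n + 'n)) \<Rightarrow> (real^('n + 'n)) set" where
  "symp_complement I e f = {x. \<forall>i\<in>I. x \<bullet> (symp_J *v e i) = 0 \<and> x \<bullet> (symp_J *v f i) = 0}"

lemma subspace_symp_complement: "subspace (symp_complement I e f)"
  by (auto simp: subspace_def symp_complement_def inner_add_left)

text \<open>The symplectic Gram-Schmidt step: the component of \<open>x\<close> along
  \<open>e i\<close> is read off by pairing with \<open>f i\<close>, and conversely. The signs of
  the two sums differ because \<open>f i\<close> pairs with \<open>e i\<close> to -1.\<close>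

lemma symp_complement_projection:
  assumes "symplectic_family I e f" "finite I"
  shows "x - (\<Sum>i\<in>I. (x \<bullet> (symp_J *v f i)) *\<^sub>R e i) + (\<Sum>i\<in>I. (x \<bullet> (symp_J *v e i)) *\<^sub>R f i)
    \<in> symp_complement I e f"
proof -
  have ef: "e i \<bullet> (symp_J *v f j) = (if i = j then 1 else 0)"
    "f i \<bullet> (symp_J *v e j) = - (if i = j then 1 else 0)"
    "e i \<bullet> (symp_J *v e j) = 0" "f i \<bullet> (symp_J *v f j) = 0" if "i \<in> I" "j \<in> I" for i j
    using assms(1) that dot_symp_J[of "f i" "e j"] by (auto simp: symplectic_family_def)
  have delta: "(\<Sum>i\<in>I. a i * (if i = j then 1 else 0)) = a j" if "j \<in> I" for a :: "_ \<Rightarrow> real" and j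
    using assms(2) that by (simp add: if_distrib cong: if_cong)
  show ?thesis
    by (simp add: symp_complement_def inner_add_left inner_diff_left inner_sum_left ef delta sum_negf
        cong: sum.cong)
qed

text \<open>By the projection formula the complement and the family together span the space, so
  \<open>w\<close> is orthogonal to itself. This upgrades an identity tested only on the complement
  to an identity of vectors.\<close>

lemma orthogonal_to_symp_complement_and_family:
  assumes "symplectic_family I e f" "finite I"
    and "\<And>v. v \<in> symp_complement I e f \<Longrightarrow> v \<bullet> w = 0" "\<And>i. i \<in> I \<Longrightarrow> e i \<bullet> w = 0"
    "\<And>i. i \<in> I \<Longrightarrow> f i \<bullet> w = 0"
  shows "w = 0"
proof -
  from assms(3)[OF symp_complement_projection[OF assms(1,2), of w]] assms(4,5)
  have "w \<bullet> w = 0" by (simp add: inner_add_left inner_diff_left inner_sum_left)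
  then show ?thesis by simp
qed

text \<open>Were the complement zero, the projection formula would write every vector in terms of
  \<open>2 |I| < 2n\<close> vectors.\<close>

lemma symp_complement_nonzero:
  fixes e f :: "'n \<Rightarrow> real^('n::finite + 'n)"
  assumes "symplectic_family I e f" "I \<noteq> UNIV"
  obtains x where "x \<in> symp_complement I e f" "x \<noteq> 0"
proof (rule ccontr)
  assume neg: "\<not> thesis"
  have "x \<in> span (e ` I \<union> f ` I)" for x
  proof -
    have "x - (\<Sum>i\<in>I. (x \<bullet> (symp_J *v f i)) *\<^sub>R e i) + (\<Sum>i\<in>I. (x \<bullet> (symp_J *v e i)) *\<^sub>R f i) = 0"
      using symp_complement_projection[OF assms(1) finite] neg that by blast
    then have "x = (\<Sum>i\<in>I. (x \<bullet> (symp_J *v f i)) *\<^sub>R e i) - (\<Sum>i\<in>I. (x \<bullet> (symp_J *v e i)) *\<^sub>R f i)"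
      by (simp add: algebra_simps)
    also have "\<dots> \<in> span (e ` I \<union> f ` I)"
      by (intro span_diff span_sum span_scale span_base) auto
    finally show ?thesis .
  qed
  then have "dim (UNIV :: (real^('n + 'n)) set) \<le> card (e ` I \<union> f ` I)"
    by (intro dim_le_card) auto
  also have "\<dots> \<le> card I + card I"
    by (meson card_Un_le card_image_le add_mono finite order_trans)
  also have "\<dots> < CARD('n) + CARD('n)"
    using psubset_card_mono[of UNIV I] assms(2) by (simp add: psubset_eq)
  finally show False by simp
qed

lemma williamson_family:
  fixes S :: "'n::finite rmat2" and I :: "'n set"
  assumes S: "S \<in> K"
  shows "\<exists>e f d. symplectic_family I e f \<and>
    (\<forall>i\<in>I. d i \<ge> (1/2::real) \<and> S *v e i = d i *\<^sub>R (symp_J *v f i) \<and> S *v f i = - d i *\<^sub>R (symp_J *v e i))"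
    (is "\<exists>e f d. ?P I e f d")
  using finite[of I]
proof (induction I rule: finite_induct)
  case empty
  then show ?case by (simp add: symplectic_family_def)
next
  case (insert k I)
  from insert.IH obtain e f :: "'n \<Rightarrow> real^('n + 'n)" and d where P: "?P I e f d" by blast
  then have fam: "symplectic_family I e f" by blast
  let ?V = "symp_complement I e f"
  obtain x where x: "x \<in> ?V" "x \<noteq> 0" using symp_complement_nonzero[OF fam] insert.hyps by blast
  \<comment> \<open>A pair with positive pairing is needed to start the maximisation.
    \<open>- J x\<close> pairs with \<open>x\<close> to \<open>x\<^sup>T x\<close>, and its
    projection \<open>y\<close> to the complement keeps this value because \<open>x\<close> pairs to
    zero with the whole family.\<close>
  define y1 where "y1 = - (symp_J *v x)"
  define y where "y = y1 - (\<Sum>i\<in>I. (y1 \<bullet> (symp_J *v f i)) *\<^sub>R e i) + (\<Sum>i\<in>I. (y1 \<bullet> (symp_J *v e i)) *\<^sub>R f i)"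
  have y: "y \<in> ?V" unfolding y_def using symp_complement_projection[OF fam] by simp
  have "x \<bullet> (symp_J *v y) = - (y \<bullet> (symp_J *v x))" by (rule dot_symp_J)
  also have "\<dots> = - (y1 \<bullet> (symp_J *v x))"
  proof -
    have "e i \<bullet> (symp_J *v x) = 0" "f i \<bullet> (symp_J *v x) = 0" if "i \<in> I" for i
      using x(1) that dot_symp_J[of "e i" x] dot_symp_J[of "f i" x] by (auto simp: symp_complement_def)
    then show ?thesis by (simp add: y_def inner_add_left inner_diff_left inner_sum_left)
  qed
  also have "\<dots> = x \<bullet> x" by (simp add: y1_def norm_symp_J)
  finally have "x \<bullet> (symp_J *v y) > 0" using x(2) by simp
  from williamson_pair[OF S subspace_symp_complement x(1) y this]
  obtain e' f' d' where new: "e' \<in> ?V" "f' \<in> ?V" "d' \<ge> 1/2" "e' \<bullet> (symp_J *v f') = 1"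
    "\<And>h. h \<in> ?V \<Longrightarrow> h \<bullet> (S *v e') = d' * (h \<bullet> (symp_J *v f'))"
    "\<And>h. h \<in> ?V \<Longrightarrow> h \<bullet> (S *v f') = - d' * (h \<bullet> (symp_J *v e'))"
    by blast
  have sym: "transpose S = S" using S by (simp add: K_iff)
  \<comment> \<open>The last two facts use the induction hypothesis:
    \<open>e i \<bullet> S v = v \<bullet> S (e i)\<close> is a multiple of
    \<open>v \<bullet> J (f i)\<close>, hence 0, and likewise for \<open>f i\<close>.\<close>
  have perp: "v \<bullet> (symp_J *v e i) = 0" "v \<bullet> (symp_J *v f i) = 0"
    "e i \<bullet> (symp_J *v v) = 0" "f i \<bullet> (symp_J *v v) = 0"
    "e i \<bullet> (S *v v) = 0" "f i \<bullet> (S *v v) = 0" if "v \<in> ?V" "i \<in> I" for v i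
    using that P dot_symp_J[of _ v] dot_symmetric[OF sym, of _ v]
    by (auto simp: symp_complement_def)
  \<comment> \<open>The maximising pair satisfies its equations only when tested against the
    complement; tested against the old family, both terms vanish by \<open>perp\<close>.\<close>
  have "S *v e' - d' *\<^sub>R (symp_J *v f') = 0"
    by (rule orthogonal_to_symp_complement_and_family[OF fam]) (simp_all add: inner_diff_right new perp)
  moreover have "S *v f' + d' *\<^sub>R (symp_J *v e') = 0"
    by (rule orthogonal_to_symp_complement_and_family[OF fam]) (simp_all add: inner_add_right new perp)
  ultimately have eqs: "S *v e' = d' *\<^sub>R (symp_J *v f')" "S *v f' = - d' *\<^sub>R (symp_J *v e')"
    by (simp_all add: eq_neg_iff_add_eq_0)
  have "?P (insert k I) (e(k := e')) (f(k := f')) (d(k := d'))"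
    using P new(1-4) eqs perp insert.hyps
    by (auto simp: symplectic_family_def dot_symp_J_self)
  then show ?case by blast
qed

section \<open>Symplectic matrices, Williamson's normal form and its splitting into two
  squares\<close>

lemma matrix_eq_dot: "(A::real^'m^'m) = B \<longleftrightarrow> (\<forall>x y. x \<bullet> (A *v y) = x \<bullet> (B *v y))"
  by (metis matrix_eq vector_eq_ldot)

lemma gram_columns: "(transpose E ** A ** E) $ i $ j = column i E \<bullet> (A *v column j (E::real^'m^'m))"
  unfolding dot_matrix_vector
  by (simp add: matrix_matrix_mult_def transpose_def column_def sum_distrib_right)
    (subst sum.swap, rule refl)

lemma matrix_add_rdistrib: "((A::real^'m^'m) + B) ** C = A ** C + B ** C"
  by (simp add: matrix_eq matrix_vector_mul_assoc[symmetric] matrix_vector_mult_add_rdistrib)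

lemma Sp_mult: "L \<in> Sp \<Longrightarrow> M \<in> Sp \<Longrightarrow> L ** M \<in> Sp"
proof -
  assume "L \<in> Sp" "M \<in> Sp"
  have "transpose (L ** M) ** symp_J ** (L ** M) = transpose M ** (transpose L ** symp_J ** L) ** M"
    by (simp add: matrix_transpose_mul matrix_mul_assoc)
  then show "L ** M \<in> Sp" using \<open>L \<in> Sp\<close> \<open>M \<in> Sp\<close> by (simp add: Sp_def)
qed

lemma dot_gram: "(L *v x) \<bullet> (A *v (L *v y)) = x \<bullet> ((transpose L ** A ** L) *v (y::real^'m))"
  using dot_matrix_transpose[of x "transpose L" "A *v (L *v y)"]
  by (simp only: transpose_transpose matrix_vector_mul_assoc matrix_mul_assoc)

lemma Sp_iff_dot:
  "L \<in> Sp \<longleftrightarrow> (\<forall>x y. (L *v x) \<bullet> (symp_J *v (L *v y)) = x \<bullet> (symp_J *v y))"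
  by (simp only: Sp_def mem_Collect_eq matrix_eq_dot dot_gram)

lemma Sp_dot: "L \<in> Sp \<Longrightarrow> (L *v x) \<bullet> (symp_J *v (L *v y)) = x \<bullet> (symp_J *v y)"
  by (simp add: Sp_iff_dot)

lemma Sp_inverse:
  assumes "E \<in> Sp"
  obtains L where "L \<in> Sp" "L ** E = mat 1" "E ** L = mat 1"
proof
  \<comment> \<open>From \<open>E\<^sup>T J E = J\<close> and \<open>J\<^sup>2 = - 1\<close> it
    follows that \<open>- J E\<^sup>T J E = - J\<^sup>2 = 1\<close>.\<close>
  define L where "L = - (symp_J ** transpose E ** symp_J)"
  have "L ** E = - (symp_J ** (transpose E ** symp_J ** E))"
    by (simp add: L_def matrix_mul_assoc matrix_eq uminus_matrix_vector_mult matrix_vector_mul_assoc[symmetric])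
  then show LE: "L ** E = mat 1" using assms by (simp add: Sp_def symp_J_squared)
  then show EL: "E ** L = mat 1" using matrix_left_right_inverse by blast
  have "(L *v x) \<bullet> (symp_J *v (L *v y)) = x \<bullet> (symp_J *v y)" for x y
    using Sp_dot[OF assms, of "L *v x" "L *v y"] EL by (simp add: matrix_vector_mul_assoc)
  then show "L \<in> Sp" by (simp add: Sp_iff_dot)
qed

definition block_diag :: "('n \<Rightarrow> real) \<Rightarrow> ('n \<Rightarrow> real) \<Rightarrow> 'n::finite rmat2" where
  "block_diag a b = (\<chi> i j. if i = j then case_sum a b i else 0)"

lemma block_diag_nth:
  "(block_diag a b ** A) $ i $ j = case_sum a b i * A $ i $ j"
  "(A ** block_diag a b) $ i $ j = A $ i $ j * case_sum a b j"
proof -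
  have "(block_diag a b ** A) $ i $ j = (\<Sum>k\<in>UNIV. if i = k then case_sum a b i * A $ k $ j else 0)"
    unfolding matrix_matrix_mult_def block_diag_def vec_lambda_beta by (intro sum.cong) auto
  then show "(block_diag a b ** A) $ i $ j = case_sum a b i * A $ i $ j" by simp
  have "(A ** block_diag a b) $ i $ j = (\<Sum>k\<in>UNIV. if k = j then A $ i $ k * case_sum a b j else 0)"
    unfolding matrix_matrix_mult_def block_diag_def vec_lambda_beta by (intro sum.cong) auto
  then show "(A ** block_diag a b) $ i $ j = A $ i $ j * case_sum a b j" by simp
qed

lemma block_diag_mult:
  "block_diag a b ** block_diag a' b' = block_diag (\<lambda>i. a i * a' i) (\<lambda>i. b i * b' i)"
  by (auto simp: vec_eq_iff block_diag_nth, auto simp: block_diag_def split: sum.split)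

lemma transpose_block_diag: "transpose (block_diag a b) = block_diag a b"
  by (auto simp: vec_eq_iff block_diag_def transpose_def)

lemma block_diag_Sp:
  assumes "\<And>i. a i * b i = 1"
  shows "block_diag a b \<in> Sp"
proof -
  have ba: "b i * a i = 1" for i using assms[of i] by (simp add: mult.commute)
  have "case_sum a b i * symp_J $ i $ j * case_sum a b j = symp_J $ i $ j" for i j
    by (cases i; cases j) (simp_all add: symp_J_nth assms ba)
  then show ?thesis by (simp add: Sp_def transpose_block_diag vec_eq_iff block_diag_nth)
qed

text \<open>With a full symplectic family as columns, a matrix \<open>E\<close> brings
  \<open>J\<close> to itself and \<open>S\<close> to diagonal form at once; \<open>L\<close> is the
  inverse of \<open>E\<close>.\<close>

lemma williamson:
  fixes S :: "'n::finite rmat2"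
  assumes S: "S \<in> K"
  obtains L d where "L \<in> Sp" "\<And>i. d i \<ge> 1/2" "S = transpose L ** block_diag d d ** L"
proof -
  obtain e f d where fam: "symplectic_family UNIV e f"
    and d: "\<And>i::'n. d i \<ge> (1/2::real)" "\<And>i. S *v e i = d i *\<^sub>R (symp_J *v f i)"
      "\<And>i. S *v f i = - d i *\<^sub>R (symp_J *v e i)"
    using williamson_family[OF S, of UNIV] by blast
  have J: "e i \<bullet> (symp_J *v f j) = (if i = j then 1 else 0)" "f i \<bullet> (symp_J *v e j) = (if i = j then - 1 else 0)"
    "e i \<bullet> (symp_J *v e j) = 0" "f i \<bullet> (symp_J *v f j) = 0" for i j
    using fam dot_symp_J[of "f i" "e j"] by (auto simp: symplectic_family_def)
  \<comment> \<open>The vectors \<open>f\<close> come first because the upper right block of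
    \<open>symp_J\<close> is \<open>- I\<close>, matching the pairing -1 of \<open>f i\<close> with
    \<open>e i\<close>.\<close>
  define E where "E = (\<chi> i j. case_sum f e j $ i)"
  have col: "column j E = case_sum f e j" for j
    by (simp add: E_def column_def vec_eq_iff)
  have "(transpose E ** symp_J ** E) $ i $ j = symp_J $ i $ j" for i j
    by (cases i; cases j) (simp_all add: gram_columns col J symp_J_nth)
  then have E: "E \<in> Sp" by (simp add: Sp_def vec_eq_iff)
  have "(transpose E ** S ** E) $ i $ j = block_diag d d $ i $ j" for i j
    by (cases i; cases j) (simp_all add: gram_columns col J d block_diag_def)
  then have D: "transpose E ** S ** E = block_diag d d" by (simp add: vec_eq_iff)
  obtain L where L: "L \<in> Sp" "E ** L = mat 1" using Sp_inverse[OF E] by blast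
  have "transpose L ** block_diag d d ** L = transpose (E ** L) ** S ** (E ** L)"
    by (simp add: D[symmetric] matrix_transpose_mul matrix_mul_assoc)
  then have "S = transpose L ** block_diag d d ** L" by (simp add: L(2) transpose_mat)
  with L(1) d(1) show ?thesis using that by blast
qed

text \<open>For \<open>a = exp (r / 2)\<close> the right-hand side is \<open>2 cosh r\<close>, so
  \<open>cosh r = 2 d\<close> must be solved; this is possible because
  \<open>2 d \<ge> 1\<close>.\<close>

lemma double_cosh:
  assumes "d \<ge> (1/2::real)"
  obtains a where "a > 0" "4 * d = a\<^sup>2 + (1 / a)\<^sup>2"
proof
  let ?r = "arcosh (2 * d)"
  show "exp (?r / 2) > 0" by simp
  have "4 * d = 2 * cosh ?r" using assms by (simp add: cosh_arcosh_real)
  also have "\<dots> = (exp (?r / 2))\<^sup>2 + (1 / exp (?r / 2))\<^sup>2"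
    by (simp add: cosh_field_def exp_minus power_divide inverse_eq_divide flip: exp_double)
  finally show "4 * d = (exp (?r / 2))\<^sup>2 + (1 / exp (?r / 2))\<^sup>2" .
qed

lemma K_decomposition:
  fixes S :: "'n::finite rmat2"
  assumes "S \<in> K"
  shows "\<exists>L\<in>Sp. \<exists>M\<in>Sp. S = (1/4) *\<^sub>R (transpose L ** L + transpose M ** M)"
proof -
  obtain L d where L: "L \<in> Sp" "\<And>i. d i \<ge> 1/2" "S = transpose L ** block_diag d d ** L"
    using williamson[OF assms] by blast
  have "\<forall>i. \<exists>a. a > 0 \<and> 4 * d i = a\<^sup>2 + (1 / a)\<^sup>2" using double_cosh L(2) by metis
  then obtain a where a: "\<And>i. a i > 0" "\<And>i. 4 * d i = (a i)\<^sup>2 + (1 / a i)\<^sup>2" by metis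
  let ?A = "block_diag a (\<lambda>i. 1 / a i)" and ?B = "block_diag (\<lambda>i. 1 / a i) a"
  have AB: "?A \<in> Sp" "?B \<in> Sp" using a(1) by (auto intro!: block_diag_Sp simp: less_imp_neq[symmetric])
  have "4 *\<^sub>R block_diag d d = ?A ** ?A + ?B ** ?B"
    unfolding block_diag_mult using a(2)
    by (auto simp: vec_eq_iff block_diag_def power2_eq_square split: sum.split)
  then have D: "block_diag d d = (1/4) *\<^sub>R (?A ** ?A + ?B ** ?B)"
    by (metis (no_types) divide_self_if mult.commute scaleR_one scaleR_scaleR times_divide_eq_right zero_neq_numeral)
  \<comment> \<open>Since \<open>?A\<close> is symmetric, \<open>L\<^sup>T ?A ?A L\<close> is the
    Gram matrix of \<open>?A L\<close>; the same holds for \<open>?B\<close>.\<close>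
  have "S = (1/4) *\<^sub>R (transpose (?A ** L) ** (?A ** L) + transpose (?B ** L) ** (?B ** L))"
    unfolding L(3) D scalar_matrix_assoc[symmetric] matrix_scalar_ac[of _ "1/4"]
    by (simp add: matrix_transpose_mul transpose_block_diag matrix_mul_assoc matrix_add_ldistrib
        matrix_add_rdistrib)
  then show ?thesis using Sp_mult AB L(1) by blast
qed

section \<open>Half Gram matrices of symplectic matrices as the extreme points of
  \<open>K\<close>\<close>

lemma gram_dot: "x \<bullet> ((transpose L ** L) *v y) = (L *v x) \<bullet> (L *v (y::real^'m))"
  using dot_gram[of L x "mat 1" y] by simp

text \<open>Completing the square: the cross term of the squared norm is
  \<open>2 (L x) \<bullet> J (L y)\<close>, which equals \<open>2 x \<bullet> J y\<close> for
  symplectic \<open>L\<close>. This gives membership in \<open>K\<close> and locates the zeros of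
  the form, \<open>L x = - J L y\<close>.\<close>

lemma gram_form:
  assumes "L \<in> Sp"
  shows "x \<bullet> (((1/2) *\<^sub>R (transpose L ** L)) *v x) + y \<bullet> (((1/2) *\<^sub>R (transpose L ** L)) *v y) + x \<bullet> (symp_J *v y)
    = 1/2 * (norm (L *v x + symp_J *v (L *v y)))\<^sup>2"
  by (simp add: scaleR_matrix_vector_assoc[symmetric] gram_dot power2_norm_eq_inner inner_add
      norm_symp_J inner_commute[of "symp_J *v (L *v y)"] Sp_dot[OF assms] algebra_simps)

lemma half_gram_K:
  assumes "L \<in> Sp"
  shows "(1/2) *\<^sub>R (transpose L ** L) \<in> K"
  unfolding K_iff gram_form[OF assms] by (simp add: transpose_scalar matrix_transpose_mul)

lemma convex_K: "convex (K :: 'n::finite rmat2 set)"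
proof (rule convexI)
  fix A B :: "'n rmat2" and u v :: real
  assume K: "A \<in> K" "B \<in> K" and uv: "0 \<le> u" "0 \<le> v" "u + v = 1"
  have "0 \<le> x \<bullet> ((u *\<^sub>R A + v *\<^sub>R B) *v x) + y \<bullet> ((u *\<^sub>R A + v *\<^sub>R B) *v y) + x \<bullet> (symp_J *v y)" for x y
  proof -
    have "x \<bullet> ((u *\<^sub>R A + v *\<^sub>R B) *v x) + y \<bullet> ((u *\<^sub>R A + v *\<^sub>R B) *v y) + (u + v) * (x \<bullet> (symp_J *v y))
      = u * (x \<bullet> (A *v x) + y \<bullet> (A *v y) + x \<bullet> (symp_J *v y)) + v * (x \<bullet> (B *v x) + y \<bullet> (B *v y) + x \<bullet> (symp_J *v y))"
      by (simp add: matrix_vector_mult_add_rdistrib scaleR_matrix_vector_assoc[symmetric] algebra_simps)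
    also have "\<dots> \<ge> 0" using K uv by (simp add: K_iff)
    finally show ?thesis using uv by simp
  qed
  moreover have "transpose (u *\<^sub>R A + v *\<^sub>R B) = u *\<^sub>R A + v *\<^sub>R B"
    using K by (simp add: K_iff vec_eq_iff transpose_def)
  ultimately show "u *\<^sub>R A + v *\<^sub>R B \<in> K" by (simp add: K_iff)
qed

lemma average_half_gram:
  "(1/4) *\<^sub>R (transpose L ** L + transpose M ** M) =
    (1/2) *\<^sub>R ((1/2) *\<^sub>R (transpose L ** L)) + (1/2) *\<^sub>R ((1/2) *\<^sub>R (transpose M ** (M::real^'m^'m)))"
  by (simp add: scaleR_add_right)

lemma K_midpoint:
  fixes L M :: "'n::finite rmat2"
  assumes "L \<in> Sp" "M \<in> Sp"
  shows "(1/4) *\<^sub>R (transpose L ** L + transpose M ** M) \<in> K"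
  unfolding average_half_gram using assms
  by (intro convexD[OF convex_K] half_gram_K) auto

text \<open>The form of \<open>S\<close> vanishes at \<open>(x, y)\<close> when \<open>L x = - J L y\<close>, hence so does that of \<open>A\<close>;
  stationarity there gives \<open>A y = J x / 2\<close>, which determines \<open>A\<close>.\<close>

lemma half_gram_segment:
  fixes A B :: "'n::finite rmat2"
  assumes L: "L \<in> Sp" and K: "A \<in> K" "B \<in> K" and u: "0 < u" "u < 1"
    and eq: "(1/2) *\<^sub>R (transpose L ** L) = (1 - u) *\<^sub>R A + u *\<^sub>R B"
  shows "A = (1/2) *\<^sub>R (transpose L ** L)"
proof -
  let ?S = "(1/2) *\<^sub>R (transpose L ** L)"
  let ?q = "\<lambda>A x y. x \<bullet> (A *v x) + y \<bullet> (A *v y) + x \<bullet> ((symp_J :: 'n rmat2) *v y)"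
  obtain M where M: "L ** M = mat 1" using Sp_inverse[OF L] by blast
  have "A *v y = ?S *v y" for y
  proof -
    define x where "x = - (M *v (symp_J *v (L *v y)))"
    have "L *v (M *v v) = v" for v by (simp add: matrix_vector_mul_assoc M)
    then have "L *v x = - (symp_J *v (L *v y))" by (simp add: x_def vec.neg)
    then have S0: "?q ?S x y = 0" by (simp add: gram_form[OF L])
    \<comment> \<open>A combination with positive weights of two nonnegative numbers is zero only if
      both are.\<close>
    have "?q ?S x y = (1 - u) * ?q A x y + u * ?q B x y"
      unfolding eq by (simp add: matrix_vector_mult_add_rdistrib scaleR_matrix_vector_assoc[symmetric] algebra_simps)
    moreover have "?q A x y \<ge> 0" "?q B x y \<ge> 0" using K by (auto simp: K_iff)
    ultimately have A0: "?q A x y = 0" using S0 u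
      by (smt (verit) mult_nonneg_nonneg mult_pos_pos)
    have stat: "2 * (h \<bullet> (T *v y)) = h \<bullet> (symp_J *v x)" if "T \<in> K" "?q T x y = 0" for T h
      using stationary_at_zero(2)[of T symp_J UNIV x y h] that
      by (simp add: K_iff transpose_symp_J)
    have "h \<bullet> (A *v y) = h \<bullet> (?S *v y)" for h
      using stat[OF K(1) A0, of h] stat[OF half_gram_K[OF L] S0, of h] by linarith
    then show ?thesis by (metis vector_eq_ldot)
  qed
  then show ?thesis by (simp add: matrix_eq)
qed

lemma half_gram_extreme:
  assumes L: "L \<in> Sp"
  shows "(1/2) *\<^sub>R (transpose L ** L) extreme_point_of K"
  unfolding extreme_point_of_def
proof (intro conjI ballI half_gram_K L notI)
  fix A B assume AB: "A \<in> K" "B \<in> K" "(1/2) *\<^sub>R (transpose L ** L) \<in> open_segment A B"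
  then obtain u where u: "A \<noteq> B" "0 < u" "u < 1" and eq: "(1/2) *\<^sub>R (transpose L ** L) = (1 - u) *\<^sub>R A + u *\<^sub>R B"
    by (auto simp: in_segment)
  have "A = (1/2) *\<^sub>R (transpose L ** L)" by (rule half_gram_segment[OF L AB(1,2) u(2,3) eq])
  \<comment> \<open>The segment lemma identifies the first endpoint; reversing the segment, with
    parameter \<open>1 - u\<close>, covers the second.\<close>
  moreover have "B = (1/2) *\<^sub>R (transpose L ** L)"
    by (rule half_gram_segment[OF L AB(2,1), of "1 - u"]) (use u eq in \<open>simp_all add: add.commute\<close>)
  ultimately show False using u(1) by simp
qed

lemma extreme_half_gram:
  fixes S :: "'n::finite rmat2"
  assumes ext: "S extreme_point_of K"
  shows "\<exists>L\<in>Sp. S = (1/2) *\<^sub>R (transpose L ** L)"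
proof -
  have "S \<in> K" using ext by (simp add: extreme_point_of_def)
  then obtain L M where LM: "L \<in> Sp" "M \<in> Sp" and S: "S = (1/4) *\<^sub>R (transpose L ** L + transpose M ** M)"
    using K_decomposition by blast
  let ?A = "(1/2) *\<^sub>R (transpose L ** L)" and ?B = "(1/2) *\<^sub>R (transpose M ** M)"
  have mid: "S = midpoint ?A ?B"
    unfolding S average_half_gram midpoint_def by (simp add: scaleR_add_right)
  \<comment> \<open>The midpoint of two distinct points lies in their open segment, so extremality
    forces the two half Gram matrices to coincide.\<close>
  have "S \<notin> open_segment ?A ?B" using ext half_gram_K LM unfolding extreme_point_of_def by blast
  then have "?A = ?B" unfolding mid by simp
  then have "S = ?A" unfolding mid by simp
  then show ?thesis using LM(1) by blast
qed

theorem theorem3p5: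
  fixes S :: "real ^ ('n::finite + 'n) ^ ('n + 'n)"
  assumes "real_pos_def S"
  shows "(S \<in> K \<longleftrightarrow>
            (\<exists>L\<in>Sp. \<exists>M\<in>Sp. S = (1/4) *\<^sub>R (transpose L ** L + transpose M ** M))) \<and>
         (S extreme_point_of K \<longleftrightarrow> (\<exists>L\<in>Sp. S = (1/2) *\<^sub>R (transpose L ** L)))"
  using K_decomposition K_midpoint extreme_half_gram half_gram_extreme by metis

end
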